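(* Let $d\ge 1$ and $2\le k\le r$ be integers. Then $T(d,r,k)\ge r\left(\frac{k-1}{k}\cdot d+1\right)$.
   Context: For integers $d\ge1$ and $2\le k\le r$, $T(d,r,k)$ denotes the minimum number $n$ such that any $n$ points $a_1,\dots,a_n\in\mathbb{R}^d$ (not necessarily distinct) admit a partition of the index set $\{1,\dots,n\}$ into $r$ pairwise disjoint sets $I_1,\dots,I_r$ such that any $k$ of the convex hulls $\operatorname{conv}\{a_i : i\in I_1\},\dots,\operatorname{conv}\{a_i : i\in I_r\}$ have a common point. *)

theory Defs
  imports "HOL-Analysis.Analysis"
begin

text \<open>The space \<open>\<real>\<^sup>d\<close> is \<^typ>\<open>real ^ 'd\<close> with \<open>d = CARD('d)\<close>. The parts are selected by their
  indices: equal hulls with different indices count separately. Parts may be empty a priori, but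
  for \<open>2 \<le> k \<le> r\<close> the intersection condition excludes this.\<close>

definition tverberg_partition ::
  "nat \<Rightarrow> nat \<Rightarrow> nat \<Rightarrow> (nat \<Rightarrow> real ^ 'd) \<Rightarrow> (nat \<Rightarrow> nat set) \<Rightarrow> bool" where
  "tverberg_partition n r k a I \<longleftrightarrow>
     (\<Union>j\<in>{1..r}. I j) = {1..n} \<and>
     disjoint_family_on I {1..r} \<and>
     (\<forall>J. J \<subseteq> {1..r} \<and> card J = k \<longrightarrow> (\<Inter>j\<in>J. convex hull (a ` I j)) \<noteq> {})"

text \<open>The type argument carries the dimension. \<open>LEAST\<close> on \<^typ>\<open>nat\<close> is unspecified if no \<open>n\<close>
  qualifies; by Tverberg's theorem some \<open>n\<close> always does when \<open>2 \<le> k \<le> r\<close>.\<close>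

definition tverberg_number :: "'d::finite itself \<Rightarrow> nat \<Rightarrow> nat \<Rightarrow> nat" where
  "tverberg_number (_ :: 'd itself) r k =
     (LEAST n. \<forall>a :: nat \<Rightarrow> real ^ 'd. \<exists>I. tverberg_partition n r k a I)"

end

theory Submission
  imports Defs
begin

text \<open>
  Choose the \<open>n\<close> points generically and lift each point \<open>a\<close> to \<open>(a, 1)\<close> in a space of dimension
  \<open>D = d + 1\<close>. The spans of lifted points over pairwise disjoint index sets \<open>I\<close> then intersect
  in a subspace of dimension at most \<open>D - (\<Sum>I. D - card I)\<close>. A common point of \<open>k\<close> hulls
  lifts to a nonzero vector in such an intersection, so \<open>(\<Sum>I. D - card I) \<le> d\<close> for any \<open>k\<close>
  parts. Averaging over all choices of \<open>k\<close> parts gives \<open>k * (r * D - n) \<le> r * d\<close>.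

  Since the Tverberg number is a \<open>LEAST\<close>, some \<open>n\<close> has to be shown to qualify: for
  \<open>n > (d + 1)\<^sup>2 * r\<close>, Helly's theorem yields a point \<open>p\<close> that stays in the hull after the
  removal of any \<open>(d + 1) * r\<close> points, and Caratheodory's theorem lets us split off parts with at
  most \<open>d + 1\<close> points and \<open>p\<close> in their hull one after another.
\<close>

section \<open>Vectors in general position\<close>

text \<open>Proper subspaces are null sets, so finitely many of them cannot cover the space;
  rescaling a vector outside them keeps it outside.\<close>

lemma exists_inner_one_avoiding_subspaces:
  fixes w :: "'b::euclidean_space"
  assumes "finite U" and sub: "\<And>S. S \<in> U \<Longrightarrow> subspace S \<and> S \<noteq> UNIV" and "w \<noteq> 0"
  shows "\<exists>y. y \<bullet> w = 1 \<and> y \<notin> \<Union>U"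
proof -
  have low: "negligible S" if "subspace S" "S \<noteq> UNIV" for S :: "'b set"
    using that by (metis dim_eq_full dim_subset_UNIV le_neq_implies_less negligible_lowdim span_eq_iff)
  have "w \<notin> {y. w \<bullet> y = 0}" using \<open>w \<noteq> 0\<close> by simp
  then have "negligible {y. w \<bullet> y = 0}"
    using low[OF subspace_hyperplane[of w]] by blast
  \<comment> \<open>The hyperplane orthogonal to \<open>w\<close> is avoided too, so that
    \<open>y\<close> can be scaled to inner product 1.\<close>
  then have "negligible (\<Union>(insert {y. w \<bullet> y = 0} U))"
    using assms(1) sub low by (intro negligible_Union) auto
  then have "\<Union>(insert {y. w \<bullet> y = 0} U) \<noteq> UNIV"
    by (metis non_negligible_UNIV)
  then obtain y where y: "w \<bullet> y \<noteq> 0" "y \<notin> \<Union>U" by blast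
  have "y /\<^sub>R (w \<bullet> y) \<notin> S" if "S \<in> U" for S
  proof
    assume "y /\<^sub>R (w \<bullet> y) \<in> S"
    then have "(w \<bullet> y) *\<^sub>R (y /\<^sub>R (w \<bullet> y)) \<in> S"
      using sub[OF that] by (blast intro: subspace_scale)
    then show False using y that by auto
  qed
  moreover have "(y /\<^sub>R (w \<bullet> y)) \<bullet> w = 1"
    using y by (simp add: inner_commute)
  ultimately show ?thesis by blast
qed

text \<open>If an element of \<open>B\<close> involved \<open>y\<close> with a nonzero coefficient,
  solving for \<open>y\<close> would put it into the excluded sum of \<open>span V\<close> and
  \<open>B\<close>.\<close>

lemma span_insert_Int_eq:
  fixes B :: "'b::real_vector set"
  assumes "subspace B" and "y \<notin> {f + b |f b. f \<in> span V \<and> b \<in> B}"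
  shows "span (insert y V) \<inter> B = span V \<inter> B"
proof (intro equalityI subsetI)
  fix z assume "z \<in> span (insert y V) \<inter> B"
  then obtain c where c: "z - c *\<^sub>R y \<in> span V" and z: "z \<in> B"
    by (auto simp: span_breakdown_eq)
  have "c = 0"
  proof (rule ccontr)
    assume "c \<noteq> 0"
    then have "y = - (z - c *\<^sub>R y) /\<^sub>R c + z /\<^sub>R c"
      by (simp add: algebra_simps)
    moreover have "- (z - c *\<^sub>R y) /\<^sub>R c \<in> span V"
      using c by (metis span_neg span_scale)
    moreover have "z /\<^sub>R c \<in> B"
      using z assms(1) by (simp add: subspace_scale)
    ultimately show False using assms(2) by blast
  qed
  then show "z \<in> span V \<inter> B" using c z by simp
qed (use span_mono[of V "insert y V"] in auto)

text \<open>Induction on \<open>X\<close>: it suffices that the new vector avoids the finitely many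
  proper subspaces that are sums of an old span and an intersection of old spans.
  \<open>DIM('b) - card I\<close> is the expected codimension of a span; truncated subtraction makes
  it 0 for large \<open>I\<close>.\<close>

lemma exists_generic_vectors:
  fixes w :: "'b::euclidean_space" and X :: "'i set"
  assumes "finite X" and "w \<noteq> 0"
  shows "\<exists>v :: 'i \<Rightarrow> 'b. (\<forall>i\<in>X. v i \<bullet> w = 1) \<and>
    (\<forall>\<F>. \<F> \<subseteq> Pow X \<and> disjoint \<F> \<longrightarrow>
      dim (\<Inter>I\<in>\<F>. span (v ` I)) \<le> DIM('b) - (\<Sum>I\<in>\<F>. DIM('b) - card I))"
  using assms(1)
proof (induction X rule: finite_induct)
  case empty
  have "dim (\<Inter>I\<in>\<F>. span ((\<lambda>_. 0 :: 'b) ` I)) \<le> DIM('b) - (\<Sum>I\<in>\<F>. DIM('b) - card I)"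
    if "\<F> \<subseteq> Pow {}" for \<F> :: "'i set set"
  proof -
    \<comment> \<open>The intersection is the whole space for \<open>{}\<close> and the zero space
      for \<open>{{}}\<close>.\<close>
    have "\<F> = {} \<or> \<F> = {{}}" using that by auto
    then show ?thesis by (auto simp: dim_subset_UNIV)
  qed
  then show ?case by blast
next
  case (insert x X)
  let ?D = "DIM('b)"
  from insert.IH obtain v :: "'i \<Rightarrow> 'b" where v: "\<forall>i\<in>X. v i \<bullet> w = 1"
      "\<forall>\<F>. \<F> \<subseteq> Pow X \<and> disjoint \<F> \<longrightarrow>
        dim (\<Inter>I\<in>\<F>. span (v ` I)) \<le> ?D - (\<Sum>I\<in>\<F>. ?D - card I)"
    by (elim exE conjE)
  note v1 = v(1)[rule_format] and v2 = v(2)[rule_format, OF conjI]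
  define B where "B \<G> = (\<Inter>I\<in>\<G>. span (v ` I))" for \<G>
  have subB: "subspace (B \<G>)" for \<G>
    unfolding B_def by (intro subspace_Inter) auto
  define W where "W I \<G> = {f + b |f b. f \<in> span (v ` I) \<and> b \<in> B \<G>}" for I \<G>
  have subW: "subspace (W I \<G>)" for I \<G>
    unfolding W_def by (intro subspace_sums subspace_span subB)
  \<comment> \<open>A sum equal to the whole space cannot be avoided; that case is settled below by
    counting dimensions.\<close>
  define U where "U = (\<lambda>(I, \<G>). W I \<G>) ` (Pow X \<times> Pow (Pow X)) - {UNIV}"
  have "finite U"
    unfolding U_def using insert.hyps by simp
  moreover have "subspace S \<and> S \<noteq> UNIV" if "S \<in> U" for S
    using that subW unfolding U_def by auto
  ultimately obtain y where y1: "y \<bullet> w = 1" and y2: "y \<notin> \<Union>U"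
    using exists_inner_one_avoiding_subspaces[OF _ _ \<open>w \<noteq> 0\<close>, of U] by blast
  define v' where "v' = v(x := y)"
  have v'_eq: "v' ` I = v ` I" if "x \<notin> I" for I
    using that by (auto simp: v'_def)
  have "dim (\<Inter>I\<in>\<F>. span (v' ` I)) \<le> ?D - (\<Sum>I\<in>\<F>. ?D - card I)"
    if F: "\<F> \<subseteq> Pow (insert x X)" "disjoint \<F>" for \<F>
  proof (cases "x \<in> \<Union>\<F>")
    case False
    then have "\<F> \<subseteq> Pow X" "\<And>I. I \<in> \<F> \<Longrightarrow> v' ` I = v ` I"
      using F v'_eq by auto
    then show ?thesis using v2[of \<F>] F(2) by simp
  next
    case True
    \<comment> \<open>By disjointness, \<open>K\<close> is the only member whose span
      changes.\<close>
    then obtain K where K: "K \<in> \<F>" "x \<in> K" by blast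
    define I where "I = K - {x}"
    define \<G> where "\<G> = \<F> - {K}"
    have "x \<notin> L" if "L \<in> \<G>" for L
      using that F(2) K unfolding \<G>_def disjoint_def by auto
    then have GX: "\<G> \<subseteq> Pow X" and vG: "\<And>L. L \<in> \<G> \<Longrightarrow> v' ` L = v ` L"
      using F(1) v'_eq unfolding \<G>_def by blast+
    have IX: "I \<subseteq> X" and KI: "K = insert x I" "x \<notin> I"
      using K F(1) by (auto simp: I_def)
    have finI: "finite I" "finite K" and finG: "finite \<G>"
      using IX KI GX insert.hyps(1) by (auto intro: finite_subset)
    have disjG: "disjoint \<G>" using F(2) unfolding \<G>_def disjoint_def by auto
    have disjI: "disjoint (insert I \<G>)"
      using F(2) K unfolding \<G>_def I_def disjoint_def by auto
    have vK: "v' ` K = insert y (v ` I)"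
      using KI by (auto simp: v'_def)
    have Int: "(\<Inter>L\<in>\<F>. span (v' ` L)) = span (insert y (v ` I)) \<inter> B \<G>"
    proof -
      have "\<F> = insert K \<G>" using K unfolding \<G>_def by blast
      then show ?thesis using vG by (simp add: vK B_def)
    qed
    have cardK: "card K = Suc (card I)" using KI finI by simp
    define s where "s = (\<Sum>L\<in>\<G>. ?D - card L)"
    have sumF: "(\<Sum>L\<in>\<F>. ?D - card L) = (?D - card K) + s"
      using K F(1) insert.hyps(1) finG unfolding s_def \<G>_def
      by (subst sum.remove[of \<F> K]) (auto intro: finite_subset)
    have dimB: "dim (B \<G>) \<le> ?D - s"
      using v2[OF GX disjG] unfolding B_def s_def .
    show ?thesis
    proof (cases "W I \<G> = UNIV")
      case True
      let ?V = "span (insert y (v ` I))"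
      have "W I \<G> \<subseteq> {f + b |f b. f \<in> ?V \<and> b \<in> B \<G>}"
        unfolding W_def using span_mono[of "v ` I" "insert y (v ` I)"] by blast
      then have "dim {f + b |f b. f \<in> ?V \<and> b \<in> B \<G>} = ?D"
        using True dim_UNIV by (simp only: top.extremum_unique)
      \<comment> \<open>The two subspaces span everything, so the intersection has dimension at most
        \<open>card K + dim (B \<G>) - ?D\<close>. The cruder bound \<open>dim (B \<G>)\<close>
        covers the cases where a subtraction is truncated.\<close>
      then have "?D + dim (?V \<inter> B \<G>) = dim ?V + dim (B \<G>)"
        using dim_sums_Int[OF subspace_span subB, of "insert y (v ` I)" \<G>] by simp
      moreover have "dim ?V \<le> card K"
        using dim_le_card[of ?V "v' ` K"] card_image_le[OF finI(2), of v'] finI vK by fastforce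
      moreover have "dim (?V \<inter> B \<G>) \<le> dim (B \<G>)" by (intro dim_subset) auto
      ultimately show ?thesis using dimB unfolding Int sumF by linarith
    next
      case False
      have "W I \<G> \<in> U"
        using False IX GX unfolding U_def by auto
      then have "y \<notin> W I \<G>" using y2 by blast
      then have Int': "span (insert y (v ` I)) \<inter> B \<G> = span (v ` I) \<inter> B \<G>"
        unfolding W_def by (intro span_insert_Int_eq subB)
      show ?thesis
      \<comment> \<open>\<open>insert I \<G>\<close> fails to gain a member only if
        \<open>K = {x}\<close> and the empty set already belongs to \<open>\<F>\<close>; the
        intersection is then zero.\<close>
      proof (cases "I \<in> \<G>")
        case True
        then have "I \<inter> K = {}"
          using F(2) K(1) unfolding \<G>_def by (blast dest: disjointD)
        then have "I = {}" unfolding I_def by blast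
        then have "span (v ` I) \<inter> B \<G> \<subseteq> {0}" by auto
        then have "dim (span (v ` I) \<inter> B \<G>) = 0" by simp
        then show ?thesis unfolding Int Int' by linarith
      next
        case False
        have "dim (\<Inter>L\<in>insert I \<G>. span (v ` L)) \<le> ?D - (\<Sum>L\<in>insert I \<G>. ?D - card L)"
          using IX GX disjI by (intro v2) auto
        then have "dim (span (v ` I) \<inter> B \<G>) \<le> ?D - ((?D - card I) + s)"
          using False finG unfolding B_def s_def by simp
        then show ?thesis unfolding Int Int' sumF cardK by linarith
      qed
    qed
  qed
  moreover have "v' i \<bullet> w = 1" if "i \<in> insert x X" for i
    using that v1 y1 by (auto simp: v'_def)
  ultimately show ?case by blast
qed

section \<open>From generic vectors to generic points\<close>

text \<open>The points whose lift lies in a given subspace form a convex set, since convex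
  coefficients sum to 1.\<close>

lemma Pair_1_in_span_of_convex_hull:
  fixes a :: "'i \<Rightarrow> 'a::real_vector"
  assumes "x \<in> convex hull (a ` I)"
  shows "(x, 1 :: real) \<in> span ((\<lambda>i. (a i, 1)) ` I)"
proof -
  let ?S = "span ((\<lambda>i. (a i, 1 :: real)) ` I)"
  have "convex {x. (x, 1) \<in> ?S}"
  proof (rule convexI)
    fix x y and s t :: real
    assume "x \<in> {x. (x, 1) \<in> ?S}" "y \<in> {x. (x, 1) \<in> ?S}" and st: "s + t = 1"
    then have "s *\<^sub>R (x, 1 :: real) + t *\<^sub>R (y, 1 :: real) \<in> ?S"
      by (intro span_add span_scale) auto
    then show "s *\<^sub>R x + t *\<^sub>R y \<in> {x. (x, 1) \<in> ?S}" using st by simp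
  qed
  moreover have "a ` I \<subseteq> {x. (x, 1) \<in> ?S}"
    by (auto intro: span_base)
  ultimately show ?thesis
    using hull_minimal[of "a ` I" "{x. (x, 1) \<in> ?S}" convex] assms by blast
qed

lemma exists_points_with_generic_hulls:
  fixes X :: "'i set"
  assumes "finite X"
  shows "\<exists>a :: 'i \<Rightarrow> 'a::euclidean_space. \<forall>J I.
    (\<forall>j\<in>J. I j \<subseteq> X) \<and> disjoint_family_on I J \<and> (\<Inter>j\<in>J. convex hull (a ` I j)) \<noteq> {} \<longrightarrow>
    (\<Sum>j\<in>J. Suc DIM('a) - card (I j)) \<le> DIM('a)"
proof -
  \<comment> \<open>Inner product 1 with \<open>?w\<close> means last coordinate 1, so the generic
    vectors are lifts of points.\<close>
  let ?w = "(0, 1) :: 'a \<times> real" and ?D = "DIM('a \<times> real)"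
  have "?w \<noteq> 0" by (simp add: zero_prod_def)
  from exists_generic_vectors[OF assms this]
  obtain v :: "'i \<Rightarrow> 'a \<times> real" where v: "\<forall>i\<in>X. v i \<bullet> ?w = 1"
      "\<forall>\<F>. \<F> \<subseteq> Pow X \<and> disjoint \<F> \<longrightarrow>
        dim (\<Inter>I\<in>\<F>. span (v ` I)) \<le> ?D - (\<Sum>I\<in>\<F>. ?D - card I)"
    by (elim exE conjE)
  note v1 = v(1)[rule_format] and v2 = v(2)[rule_format, OF conjI]
  define a where "a i = fst (v i)" for i
  have v_eq: "v i = (a i, 1)" if "i \<in> X" for i
    using v1[OF that] by (cases "v i") (simp add: a_def)
  have "(\<Sum>j\<in>J. Suc DIM('a) - card (I j)) \<le> DIM('a)"
    if IX: "\<forall>j\<in>J. I j \<subseteq> X" and disj: "disjoint_family_on I J"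
      and ne: "(\<Inter>j\<in>J. convex hull (a ` I j)) \<noteq> {}" for J :: "'j set" and I
  proof -
    from ne obtain x where x: "\<And>j. j \<in> J \<Longrightarrow> x \<in> convex hull (a ` I j)" by blast
    \<comment> \<open>Nonempty disjoint parts are distinct sets, so the sum over indices equals the
      sum over the family of sets.\<close>
    have "I j \<noteq> {}" if "j \<in> J" for j using x[OF that] by auto
    then have inj: "inj_on I J"
      using disj unfolding inj_on_def disjoint_family_on_def by (metis inf.idem)
    have "(x, 1) \<in> span (v ` I j)" if "j \<in> J" for j
    proof -
      have "v ` I j = (\<lambda>i. (a i, 1)) ` I j"
        using IX that v_eq by (intro image_cong) auto
      then show ?thesis using Pair_1_in_span_of_convex_hull[OF x[OF that]] by simp
    qed
    then have "(x, 1) \<in> (\<Inter>L\<in>I ` J. span (v ` L))" by blast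
    then have "dim (\<Inter>L\<in>I ` J. span (v ` L)) \<noteq> 0"
      by (auto simp: dim_eq_0 zero_prod_def)
    moreover have "dim (\<Inter>L\<in>I ` J. span (v ` L)) \<le> ?D - (\<Sum>L\<in>I ` J. ?D - card L)"
      using IX disj by (intro v2 disjoint_family_on_disjoint_image) auto
    ultimately show ?thesis
      using sum.reindex[OF inj, of "\<lambda>L. ?D - card L"] by (simp del: dim_eq_0)
  qed
  then show ?thesis by blast
qed

section \<open>Averaging over subsets of size \<open>k\<close>\<close>

text \<open>Induction on the number of elements beyond \<open>k\<close>: the bounds for all sets
  \<open>A - {x}\<close> are added up, where each element of \<open>A\<close> is counted
  \<open>card A - 1\<close> times.\<close>

lemma sum_bound_from_subsets:
  fixes f :: "'i \<Rightarrow> nat"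
  assumes "finite A" and "k \<le> card A"
    and "\<And>J. J \<subseteq> A \<Longrightarrow> card J = k \<Longrightarrow> sum f J \<le> c"
  shows "k * sum f A \<le> card A * c"
  using assms
proof (induction "card A - k" arbitrary: A)
  case 0
  then show ?case by simp
next
  case (Suc m)
  obtain N where N: "card A = Suc N" using Suc.hyps(2) by (cases "card A") auto
  have IH: "k * sum f (A - {x}) \<le> N * c" if "x \<in> A" for x
  proof -
    have "card (A - {x}) = N" using that N by simp
    moreover have "sum f J \<le> c" if "J \<subseteq> A - {x}" "card J = k" for J
      using that by (intro Suc.prems) auto
    ultimately show ?thesis
      using Suc.hyps(1)[of "A - {x}"] Suc.hyps(2) Suc.prems(1) N by simp
  qed
  have "(\<Sum>x\<in>A. sum f (A - {x})) + sum f A = (\<Sum>x\<in>A. sum f (A - {x}) + f x)"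
    by (simp add: sum.distrib)
  also have "\<dots> = (\<Sum>x\<in>A. sum f A)"
    using Suc.prems(1) by (intro sum.cong) (auto simp: sum.remove add.commute)
  also have "\<dots> = N * sum f A + sum f A" by (simp add: N)
  finally have "N * (k * sum f A) = (\<Sum>x\<in>A. k * sum f (A - {x}))"
    by (simp add: sum_distrib_left[symmetric])
  also have "\<dots> \<le> (\<Sum>x\<in>A. N * c)" using IH by (intro sum_mono)
  also have "\<dots> = N * (card A * c)" by simp
  finally have "N * (k * sum f A) \<le> N * (card A * c)" .
  \<comment> \<open>The factor \<open>N\<close> can be cancelled unless \<open>k = 0\<close>, where
    the claim is trivial.\<close>
  moreover have "k = 0 \<or> 0 < N" using Suc.hyps(2) N by linarith
  ultimately show ?case by auto
qed

section \<open>Existence of Tverberg partitions\<close>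

text \<open>Any \<open>DIM('a) + 1\<close> of the removed sets together miss some index of
  \<open>X\<close>, whose point lies in all the corresponding hulls; Helly's theorem then
  applies.\<close>

lemma exists_deep_point:
  fixes a :: "'i \<Rightarrow> 'a::euclidean_space"
  assumes "finite X" and big: "Suc DIM('a) * m < card X"
  shows "\<exists>p. \<forall>T. T \<subseteq> X \<and> card T \<le> m \<longrightarrow> p \<in> convex hull (a ` (X - T))"
proof -
  define \<T> where "\<T> = {T. T \<subseteq> X \<and> card T \<le> m}"
  define h where "h T = convex hull (a ` (X - T))" for T
  have small: "\<Inter>(h ` \<S>) \<noteq> {}" if "\<S> \<subseteq> \<T>" "card \<S> \<le> Suc DIM('a)" "finite \<S>" for \<S>
  proof -
    have fin_Un: "finite (\<Union>\<S>)"
      using that(1) assms(1) by (auto simp: \<T>_def intro: finite_subset[of "\<Union>\<S>" X])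
    have "card (\<Union>\<S>) \<le> (\<Sum>T\<in>\<S>. card T)" by (rule card_Union_le_sum_card)
    also have "\<dots> \<le> (\<Sum>T\<in>\<S>. m)" using that(1) by (intro sum_mono) (auto simp: \<T>_def)
    also have "\<dots> \<le> Suc DIM('a) * m" using that(2) by (simp only: sum_constant of_nat_id mult_le_mono1)
    finally have "card (\<Union>\<S>) < card X" using big by simp
    then have "\<not> X \<subseteq> \<Union>\<S>"
      by (metis card_mono fin_Un leD)
    then obtain i where i: "i \<in> X" "i \<notin> \<Union>\<S>" by blast
    have "a i \<in> h T" if "T \<in> \<S>" for T
      unfolding h_def using i that by (auto intro: hull_inc)
    then show ?thesis by blast
  qed
  have fin: "finite \<T>" unfolding \<T>_def using assms(1) by simp
  have "\<Inter>(h ` \<T>) \<noteq> {}"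
  \<comment> \<open>Helly's theorem needs enough distinct hulls; fewer are handled directly. As
    \<open>h\<close> may identify sets, representatives are chosen injectively.\<close>
  proof (cases "card (h ` \<T>) \<le> Suc DIM('a)")
    case True
    obtain \<S> where "\<S> \<subseteq> \<T>" "inj_on h \<S>" "h ` \<T> = h ` \<S>"
      using subset_image_inj[of "h ` \<T>" h \<T>] by auto
    then show ?thesis
      using small[of \<S>] True fin by (metis card_image finite_subset)
  next
    case False
    show ?thesis
    proof (rule Helly)
      fix t assume t: "t \<subseteq> h ` \<T>" "card t = DIM('a) + 1"
      then obtain \<S> where "\<S> \<subseteq> \<T>" "inj_on h \<S>" "t = h ` \<S>"
        using subset_image_inj[of t h \<T>] by auto
      then show "\<Inter>t \<noteq> {}"
        using small[of \<S>] t fin by (simp add: card_image finite_subset)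
    qed (use False in \<open>auto simp: h_def\<close>)
  qed
  then show ?thesis unfolding h_def \<T>_def by blast
qed

lemma exists_disjoint_parts_around_deep_point:
  fixes a :: "'i \<Rightarrow> 'a::euclidean_space"
  assumes "finite X"
    and deep: "\<And>T. T \<subseteq> X \<Longrightarrow> card T \<le> r * Suc DIM('a) \<Longrightarrow> p \<in> convex hull (a ` (X - T))"
  shows "\<exists>I :: nat \<Rightarrow> 'i set. (\<forall>j\<in>{1..r}. I j \<subseteq> X \<and> card (I j) \<le> Suc DIM('a) \<and> p \<in> convex hull (a ` I j))
    \<and> disjoint_family_on I {1..r}"
  using deep
proof (induction r)
  case 0
  then show ?case by (simp add: disjoint_family_on_def)
next
  case (Suc r)
  have "\<exists>I :: nat \<Rightarrow> 'i set. (\<forall>j\<in>{1..r}. I j \<subseteq> X \<and> card (I j) \<le> Suc DIM('a)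
      \<and> p \<in> convex hull (a ` I j)) \<and> disjoint_family_on I {1..r}"
    using Suc.prems by (intro Suc.IH) auto
  then obtain I :: "nat \<Rightarrow> 'i set"
    where parts: "\<forall>j\<in>{1..r}. I j \<subseteq> X \<and> card (I j) \<le> Suc DIM('a) \<and> p \<in> convex hull (a ` I j)"
      and disj: "disjoint_family_on I {1..r}"
    by (elim exE conjE)
  note I = parts[rule_format]
  define T where "T = (\<Union>j\<in>{1..r}. I j)"
  have "card T \<le> (\<Sum>j\<in>{1..r}. card (I j))" unfolding T_def by (rule card_UN_le) simp
  also have "\<dots> \<le> (\<Sum>j\<in>{1..r}. Suc DIM('a))" using I by (intro sum_mono) blast
  finally have "card T \<le> Suc r * Suc DIM('a)" by simp
  moreover have "T \<subseteq> X" using I unfolding T_def by blast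
  ultimately have "p \<in> convex hull (a ` (X - T))" using Suc.prems by blast
  then obtain S where S: "S \<subseteq> a ` (X - T)" "card S \<le> DIM('a) + 1" "p \<in> convex hull S"
    unfolding caratheodory[of "a ` (X - T)"] by blast
  \<comment> \<open>Points may coincide; one index per point of \<open>S\<close> keeps
    \<open>card Y\<close> equal to \<open>card S\<close>.\<close>
  then obtain Y where Y: "Y \<subseteq> X - T" "inj_on a Y" "S = a ` Y"
    using subset_image_inj[of S a "X - T"] by blast
  define I' where "I' = I(Suc r := Y)"
  have "disjoint_family_on I' {1..Suc r}"
  proof -
    have "disjoint_family_on I' (insert (Suc r) {1..r})"
    proof (subst disjoint_family_on_insert)
      show "I' (Suc r) \<inter> \<Union> (I' ` {1..r}) = {} \<and> disjoint_family_on I' {1..r}"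
        using disj Y(1) by (auto simp: I'_def T_def disjoint_family_on_def)
    qed simp
    then show ?thesis by (simp add: atLeastAtMostSuc_conv)
  qed
  moreover have "I' j \<subseteq> X \<and> card (I' j) \<le> Suc DIM('a) \<and> p \<in> convex hull (a ` I' j)"
    if "j \<in> {1..Suc r}" for j
  proof (cases "j = Suc r")
    case True
    then show ?thesis using Y S by (auto simp: I'_def card_image)
  next
    case False
    then show ?thesis using I[of j] that by (auto simp: I'_def)
  qed
  ultimately show ?case by blast
qed

text \<open>The value of \<open>n\<close> is the least one that \<open>exists_deep_point\<close>
  admits when \<open>r\<close> parts of at most \<open>d + 1\<close> points are to be
  removed.\<close>

lemma exists_tverberg_partition:
  fixes a :: "nat \<Rightarrow> real ^ 'd"
  assumes "1 \<le> k" and "1 \<le> r"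
    and n: "n = Suc (Suc CARD('d) * (r * Suc CARD('d)))"
  shows "\<exists>I. tverberg_partition n r k a I"
proof -
  obtain p where "\<forall>T. T \<subseteq> {1..n} \<and> card T \<le> r * Suc CARD('d) \<longrightarrow> p \<in> convex hull (a ` ({1..n} - T))"
    using exists_deep_point[of "{1..n}" "r * Suc CARD('d)" a] n by auto
  then have "\<exists>I :: nat \<Rightarrow> nat set. (\<forall>j\<in>{1..r}. I j \<subseteq> {1..n} \<and> card (I j) \<le> Suc CARD('d)
      \<and> p \<in> convex hull (a ` I j)) \<and> disjoint_family_on I {1..r}"
    using exists_disjoint_parts_around_deep_point[of "{1..n}" r p a] by simp
  then obtain I where parts: "\<forall>j\<in>{1..r}. I j \<subseteq> {1..n} \<and> card (I j) \<le> Suc CARD('d)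
      \<and> p \<in> convex hull (a ` I j)"
    and disj: "disjoint_family_on I {1..r}"
    by (elim exE conjE)
  then have I: "I j \<subseteq> {1..n} \<and> p \<in> convex hull (a ` I j)" if "j \<in> {1..r}" for j
    using that by blast
  define I' where "I' = I(1 := {1..n} - (\<Union>j\<in>{2..r}. I j))"
  have sub: "I j \<subseteq> I' j" if "j \<in> {1..r}" for j
  proof (cases "j = 1")
    case True
    have "I 1 \<inter> I i = {}" if "i \<in> {2..r}" for i
      using disj that unfolding disjoint_family_on_def by auto
    then have "I 1 \<subseteq> {1..n} - (\<Union>j\<in>{2..r}. I j)" using True I[OF that] by blast
    then show ?thesis using True by (simp add: I'_def)
  qed (simp add: I'_def)
  have r: "{1..r} = insert 1 {2..r}" using assms(2) by auto
  have "(\<Union>j\<in>{1..r}. I' j) = {1..n}"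
  proof -
    have "(\<Union>j\<in>{2..r}. I' j) = (\<Union>j\<in>{2..r}. I j)" by (auto simp: I'_def)
    moreover have "(\<Union>j\<in>{2..r}. I j) \<subseteq> {1..n}"
      using I r by (intro UN_least) blast
    ultimately show ?thesis unfolding r by (auto simp: I'_def)
  qed
  moreover have "disjoint_family_on I' {1..r}"
    using disj unfolding disjoint_family_on_def I'_def by auto
  moreover have "(\<Inter>j\<in>J. convex hull (a ` I' j)) \<noteq> {}" if "J \<subseteq> {1..r}" for J
  proof -
    have "p \<in> convex hull (a ` I' j)" if "j \<in> {1..r}" for j
      using I[OF that] hull_mono[OF image_mono[OF sub[OF that]], of convex a] by blast
    then show ?thesis using that by blast
  qed
  ultimately have "tverberg_partition n r k a I'"
    unfolding tverberg_partition_def by simp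
  then show ?thesis by blast
qed

section \<open>The lower bound\<close>

theorem theorem2p4:
  fixes r k :: nat
  assumes "2 \<le> k" and "k \<le> r"
  shows "real (tverberg_number TYPE('d::finite) r k)
           \<ge> real r * ((real k - 1) / real k * real CARD('d) + 1)"
proof -
  let ?d = "CARD('d)"
  define n where "n = tverberg_number TYPE('d) r k"
  have "\<exists>n. \<forall>a :: nat \<Rightarrow> real ^ 'd. \<exists>I. tverberg_partition n r k a I"
    using exists_tverberg_partition[of k r] assms by auto
  then have part: "\<exists>I. tverberg_partition n r k a I" for a :: "nat \<Rightarrow> real ^ 'd"
    unfolding n_def tverberg_number_def by (rule LeastI_ex[THEN spec])
  have "\<exists>a :: nat \<Rightarrow> real ^ 'd. \<forall>(J :: nat set) I.
      (\<forall>j\<in>J. I j \<subseteq> {1..n}) \<and> disjoint_family_on I J \<and> (\<Inter>j\<in>J. convex hull (a ` I j)) \<noteq> {} \<longrightarrow>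
      (\<Sum>j\<in>J. Suc ?d - card (I j)) \<le> ?d"
    using exists_points_with_generic_hulls[where 'a = "real ^ 'd", of "{1..n}"] by simp
  then obtain a :: "nat \<Rightarrow> real ^ 'd" where a: "\<forall>(J :: nat set) I.
      (\<forall>j\<in>J. I j \<subseteq> {1..n}) \<and> disjoint_family_on I J \<and> (\<Inter>j\<in>J. convex hull (a ` I j)) \<noteq> {} \<longrightarrow>
      (\<Sum>j\<in>J. Suc ?d - card (I j)) \<le> ?d"
    by (rule exE)
  from part obtain I where U: "(\<Union>j\<in>{1..r}. I j) = {1..n}"
    and disj: "disjoint_family_on I {1..r}"
    and ne: "\<And>J. J \<subseteq> {1..r} \<Longrightarrow> card J = k \<Longrightarrow> (\<Inter>j\<in>J. convex hull (a ` I j)) \<noteq> {}"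
    unfolding tverberg_partition_def by metis
  have IX: "I j \<subseteq> {1..n}" if "j \<in> {1..r}" for j using U that by blast
  have "(\<Sum>j\<in>J. Suc ?d - card (I j)) \<le> ?d" if J: "J \<subseteq> {1..r}" "card J = k" for J
    using IX J disj ne[OF J] by (intro a[rule_format] conjI) (auto simp: disjoint_family_on_def subset_iff)
  then have "k * (\<Sum>j\<in>{1..r}. Suc ?d - card (I j)) \<le> card {1..r} * ?d"
    using assms by (intro sum_bound_from_subsets) auto
  then have bound: "real k * real (\<Sum>j\<in>{1..r}. Suc ?d - card (I j)) \<le> real r * real ?d"
    by (metis card_atLeastAtMost diff_Suc_1 of_nat_le_iff of_nat_mult)
  have "(\<Sum>j\<in>{1..r}. card (I j)) = n"
  proof -
    have "finite (I j)" if "j \<in> {1..r}" for j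
      using IX[OF that] finite_subset by blast
    then have "card (\<Union>j\<in>{1..r}. I j) = (\<Sum>j\<in>{1..r}. card (I j))"
      using disj unfolding disjoint_family_on_def by (intro card_UN_disjoint) auto
    then show ?thesis unfolding U by simp
  qed
  then have "real r * (real ?d + 1) - real n = (\<Sum>j\<in>{1..r}. real ?d + 1 - real (card (I j)))"
    by (simp add: sum_subtractf flip: of_nat_sum)
  \<comment> \<open>Truncated subtraction on \<open>nat\<close> can only exceed the real difference,
    so large parts do no harm.\<close>
  also have "\<dots> \<le> (\<Sum>j\<in>{1..r}. real (Suc ?d - card (I j)))"
    by (intro sum_mono) linarith
  finally have "real k * (real r * (real ?d + 1) - real n)
      \<le> real k * real (\<Sum>j\<in>{1..r}. Suc ?d - card (I j))"
    by (intro mult_left_mono) simp_all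
  also note bound
  finally have "real k * (real r * (real ?d + 1) - real n) \<le> real r * real ?d" .
  then show ?thesis
    using assms unfolding n_def[symmetric] by (simp add: field_simps)
qed

end
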